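(* For the exponential bath correlation function $\alpha(t,s)=g\,e^{-w(t-s)}$, $t\ge s$, represented as $\alpha(t,s)=\lambda U(t)V(s)$ for $t\ge s$ with $\lambda=g$, $U(t)=e^{-wt}$, $V(t)=e^{wt}$, the relaxed hierarchical system $$\frac{\partial}{\partial t}\psi_t^{(k)}=(-iH+z_tL)\psi_t^{(k)}+k\lambda V(t)L\psi_t^{(k-1)}-U(t)L^\dagger\psi_t^{(k+1)},\qquad k=0,1,\dots,N,$$ with $\psi_t^{(-1)}\equiv\psi_t^{(N+1)}\equiv0$, is equivalent to the hierarchical system derived via the standard HOPS (hierarchy of pure states) method: setting $\widetilde\psi_t^{(k)}=e^{-kwt}\psi_t^{(k)}$, it follows that $$\frac{\partial}{\partial t}\widetilde\psi_t^{(k)}=(-iH-kw+z_tL)\widetilde\psi_t^{(k)}+kgL\widetilde\psi_t^{(k-1)}-L^\dagger\widetilde\psi_t^{(k+1)},$$ which is identical to the hierarchical system derived via HOPS. In particular this covers $\alpha(t,s)=\frac{\gamma}{2}e^{-\gamma|t-s|}$, with $\lambda=\gamma/2$, $U(t)=e^{-\gamma t}$, $V(t)=e^{\gamma t}$. The same transformation applies to bath correlation functions expressed as sums of exponentials.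
   Context: $\mathcal H$ is a separable (complex) Hilbert space and $t\in[0,T]$. $H$ is a self-adjoint operator on $\mathcal H$ (system Hamiltonian), $L$ is a bounded linear operator on $\mathcal H$ (coupling operator) with adjoint $L^\dagger$, $g$, $w$ and $\gamma$ are constants, and $z_t$ is the complex-valued centered Gaussian driving noise with $\mathbb E(z_tz_s)=0$ and $\mathbb E(z_t^*z_s)=\alpha(t,s)$. $N$ is the truncation order of the hierarchy and the $\psi_t^{(k)}$ are $\mathcal H$-valued auxiliary wavefunctions, with $\psi_t^{(0)}$ the primary wavefunction. The relaxed hierarchical system arises from the non-Markovian stochastic Schrödinger equation $\frac{\partial}{\partial t}\psi_t=(-iH+z_tL)\psi_t-L^\dagger\int_0^t\mathrm ds\,\alpha(t,s)\frac{\delta}{\delta z_s}\psi_t$ (with $\frac{\delta}{\delta z_s}$ the functional derivative with respect to the noise) by substituting $\alpha(t,s)=\lambda U(t)V(s)$, $t\ge s$, and introducing auxiliary wavefunctions as successive functional derivatives of $\psi_t$; it is "relaxed" because the separable representation is required only for $t\ge s$. HOPS is the existing hierarchical method for this equation with exponential bath correlation functions; its system for $\alpha(t,s)=ge^{-w(t-s)}$ is the second one displayed in the claim. *)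

theory Defs
  imports "HOL-Probability.Probability"
begin

section \<open>Complex Hilbert spaces and operators\<close>

text \<open>
  The inner product is conjugate-linear in the first argument and linear in the second.
  Axiom \<open>cinner_self\<close> gives positivity and definiteness through the norm; completeness
  comes from class \<open>banach\<close>.
\<close>

class complex_hilbert_space = banach +
  fixes scaleC :: "complex \<Rightarrow> 'a \<Rightarrow> 'a" (infixr "*\<^sub>C" 75)
    and cinner :: "'a \<Rightarrow> 'a \<Rightarrow> complex"
  assumes scaleC_add_right: "c *\<^sub>C (x + y) = c *\<^sub>C x + c *\<^sub>C y"
    and scaleC_add_left: "(c + d) *\<^sub>C x = c *\<^sub>C x + d *\<^sub>C x"
    and scaleC_scaleC: "c *\<^sub>C (d *\<^sub>C x) = (c * d) *\<^sub>C x"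
    and scaleR_scaleC: "r *\<^sub>R x = complex_of_real r *\<^sub>C x"
    and cinner_commute: "cinner x y = cnj (cinner y x)"
    and cinner_add_right: "cinner x (y + z) = cinner x y + cinner x z"
    and cinner_scaleC_right: "cinner x (c *\<^sub>C y) = c * cinner x y"
    and cinner_self: "cinner x x = complex_of_real ((norm x)\<^sup>2)"

definition csubspace :: "'h::complex_hilbert_space set \<Rightarrow> bool" where
  "csubspace D \<longleftrightarrow>
     0 \<in> D \<and> (\<forall>x\<in>D. \<forall>y\<in>D. x + y \<in> D) \<and> (\<forall>c. \<forall>x\<in>D. c *\<^sub>C x \<in> D)"

definition clinear_on :: "'h::complex_hilbert_space set \<Rightarrow> ('h \<Rightarrow> 'h) \<Rightarrow> bool" where
  "clinear_on D A \<longleftrightarrow>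
     (\<forall>x\<in>D. \<forall>y\<in>D. A (x + y) = A x + A y) \<and> (\<forall>c. \<forall>x\<in>D. A (c *\<^sub>C x) = c *\<^sub>C A x)"

definition bounded_clinear :: "('h::complex_hilbert_space \<Rightarrow> 'h) \<Rightarrow> bool" where
  "bounded_clinear A \<longleftrightarrow> clinear_on UNIV A \<and> (\<exists>C. \<forall>x. norm (A x) \<le> C * norm x)"

text \<open>\<open>B\<close> is the (unique) Hilbert space adjoint of the everywhere defined operator \<open>A\<close>.\<close>

definition is_cadjoint :: "('h::complex_hilbert_space \<Rightarrow> 'h) \<Rightarrow> ('h \<Rightarrow> 'h) \<Rightarrow> bool" where
  "is_cadjoint A B \<longleftrightarrow> (\<forall>x y. cinner (B x) y = cinner x (A y))"

text \<open>
  A possibly unbounded operator is a total function \<open>A\<close> together with its domain \<open>D\<close>;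
  the values of \<open>A\<close> outside \<open>D\<close> carry no meaning. Self-adjointness is equality of the
  operator with its adjoint, domains included, expressed as equality of graphs.
\<close>

definition op_graph :: "'h set \<Rightarrow> ('h \<Rightarrow> 'h) \<Rightarrow> ('h \<times> 'h) set" where
  "op_graph D A = {(x, A x) | x. x \<in> D}"

definition adjoint_graph :: "'h::complex_hilbert_space set \<Rightarrow> ('h \<Rightarrow> 'h) \<Rightarrow> ('h \<times> 'h) set" where
  "adjoint_graph D A = {(y, y'). \<forall>x\<in>D. cinner y (A x) = cinner y' x}"

definition self_adjoint_operator :: "'h::complex_hilbert_space set \<Rightarrow> ('h \<Rightarrow> 'h) \<Rightarrow> bool" where
  "self_adjoint_operator D A \<longleftrightarrow>
     csubspace D \<and> clinear_on D A \<and> closure D = UNIV \<and> adjoint_graph D A = op_graph D A"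

section \<open>Driving noise\<close>

text \<open>Degenerate (almost surely constant) Gaussian variables are included.\<close>

definition real_gaussian :: "'w measure \<Rightarrow> ('w \<Rightarrow> real) \<Rightarrow> bool" where
  "real_gaussian M X \<longleftrightarrow> X \<in> borel_measurable M \<and>
     ((\<exists>\<mu> \<sigma>. 0 < \<sigma> \<and> distributed M lborel X (normal_density \<mu> \<sigma>)) \<or>
      (\<exists>\<mu>. AE \<omega> in M. X \<omega> = \<mu>))"

text \<open>
  The real parts of complex linear combinations of the \<open>z t\<close> are exactly the real linear
  combinations of the \<open>Re (z t)\<close> and \<open>Im (z t)\<close>, so the third clause says that the real
  and imaginary parts of the process are jointly Gaussian.
\<close>

definition gaussian_noise ::
  "'w measure \<Rightarrow> real \<Rightarrow> (real \<Rightarrow> real \<Rightarrow> complex) \<Rightarrow> (real \<Rightarrow> 'w \<Rightarrow> complex) \<Rightarrow> bool" where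
  "gaussian_noise M T \<alpha> z \<longleftrightarrow>
     prob_space M \<and>
     (\<forall>t\<in>{0..T}. z t \<in> borel_measurable M) \<and>
     (\<forall>S c. finite S \<and> S \<subseteq> {0..T} \<longrightarrow> real_gaussian M (\<lambda>\<omega>. Re (\<Sum>t\<in>S. c t * z t \<omega>))) \<and>
     (\<forall>t\<in>{0..T}. (\<integral>\<omega>. z t \<omega> \<partial>M) = 0) \<and>
     (\<forall>t\<in>{0..T}. \<forall>s\<in>{0..T}. (\<integral>\<omega>. z t \<omega> * z s \<omega> \<partial>M) = 0) \<and>
     (\<forall>t\<in>{0..T}. \<forall>s\<in>{0..T}. (\<integral>\<omega>. cnj (z t \<omega>) * z s \<omega> \<partial>M) = \<alpha> t s)"

section \<open>Hierarchies for one exponential\<close>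

definition separable_bcf ::
  "real \<Rightarrow> (real \<Rightarrow> real \<Rightarrow> complex) \<Rightarrow> complex \<Rightarrow> (real \<Rightarrow> complex) \<Rightarrow> (real \<Rightarrow> complex) \<Rightarrow> bool" where
  "separable_bcf T \<alpha> \<Lambda> U V \<longleftrightarrow>
     (\<forall>s t. 0 \<le> s \<and> s \<le> t \<and> t \<le> T \<longrightarrow> \<alpha> t s = \<Lambda> * U t * V s)"

text \<open>The wavefunction of order \<open>k - 1\<close>, with the convention that order \<open>-1\<close> vanishes.\<close>

definition lower :: "(nat \<Rightarrow> real \<Rightarrow> 'h::zero) \<Rightarrow> nat \<Rightarrow> real \<Rightarrow> 'h" where
  "lower \<psi> k t = (if k = 0 then 0 else \<psi> (k - 1) t)"

text \<open>
  Both hierarchies are driven by one noise path \<open>\<zeta>\<close>. A solution is a strong solution: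
  every \<open>\<psi> k t\<close> lies in the domain of \<open>H\<close> and the time derivative exists in norm
  (one-sided at the end points of \<open>{0..T}\<close>).
\<close>

definition relaxed_hierarchy ::
  "'h::complex_hilbert_space set \<Rightarrow> ('h \<Rightarrow> 'h) \<Rightarrow> ('h \<Rightarrow> 'h) \<Rightarrow> ('h \<Rightarrow> 'h) \<Rightarrow> real \<Rightarrow> nat \<Rightarrow>
   complex \<Rightarrow> (real \<Rightarrow> complex) \<Rightarrow> (real \<Rightarrow> complex) \<Rightarrow> (real \<Rightarrow> complex) \<Rightarrow>
   (nat \<Rightarrow> real \<Rightarrow> 'h) \<Rightarrow> bool" where
  "relaxed_hierarchy D H L Ld T N \<Lambda> U V \<zeta> \<psi> \<longleftrightarrow>
     (\<forall>t\<in>{0..T}. \<psi> (N + 1) t = 0) \<and>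
     (\<forall>k\<le>N. \<forall>t\<in>{0..T}. \<psi> k t \<in> D \<and>
        (\<psi> k has_vector_derivative
           ((- \<i>) *\<^sub>C H (\<psi> k t) + \<zeta> t *\<^sub>C L (\<psi> k t)
            + (of_nat k * \<Lambda> * V t) *\<^sub>C L (lower \<psi> k t)
            - U t *\<^sub>C Ld (\<psi> (k + 1) t))) (at t within {0..T}))"

definition hops_hierarchy ::
  "'h::complex_hilbert_space set \<Rightarrow> ('h \<Rightarrow> 'h) \<Rightarrow> ('h \<Rightarrow> 'h) \<Rightarrow> ('h \<Rightarrow> 'h) \<Rightarrow> real \<Rightarrow> nat \<Rightarrow>
   complex \<Rightarrow> complex \<Rightarrow> (real \<Rightarrow> complex) \<Rightarrow> (nat \<Rightarrow> real \<Rightarrow> 'h) \<Rightarrow> bool" where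
  "hops_hierarchy D H L Ld T N g w \<zeta> \<phi> \<longleftrightarrow>
     (\<forall>t\<in>{0..T}. \<phi> (N + 1) t = 0) \<and>
     (\<forall>k\<le>N. \<forall>t\<in>{0..T}. \<phi> k t \<in> D \<and>
        (\<phi> k has_vector_derivative
           ((- \<i>) *\<^sub>C H (\<phi> k t) - (of_nat k * w) *\<^sub>C \<phi> k t + \<zeta> t *\<^sub>C L (\<phi> k t)
            + (of_nat k * g) *\<^sub>C L (lower \<phi> k t)
            - Ld (\<phi> (k + 1) t))) (at t within {0..T}))"

definition hops_transform ::
  "complex \<Rightarrow> (nat \<Rightarrow> real \<Rightarrow> 'h::complex_hilbert_space) \<Rightarrow> nat \<Rightarrow> real \<Rightarrow> 'h" where
  "hops_transform w \<psi> = (\<lambda>k t. exp (- (of_nat k * w * of_real t)) *\<^sub>C \<psi> k t)"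

section \<open>Hierarchies for a sum of exponentials\<close>

text \<open>
  The terms of the sum are indexed by a finite type \<open>'j\<close> and the wavefunctions by
  multi-indices \<open>k :: 'j \<Rightarrow> nat\<close>. The hierarchy is truncated to a set \<open>K\<close> of multi-indices;
  for instance \<open>K = {k. sum k UNIV \<le> N}\<close> is truncation at total order \<open>N\<close>.
\<close>

definition separable_bcf_sum ::
  "real \<Rightarrow> (real \<Rightarrow> real \<Rightarrow> complex) \<Rightarrow> ('j::finite \<Rightarrow> complex) \<Rightarrow>
   ('j \<Rightarrow> real \<Rightarrow> complex) \<Rightarrow> ('j \<Rightarrow> real \<Rightarrow> complex) \<Rightarrow> bool" where
  "separable_bcf_sum T \<alpha> \<Lambda> U V \<longleftrightarrow>
     (\<forall>s t. 0 \<le> s \<and> s \<le> t \<and> t \<le> T \<longrightarrow> \<alpha> t s = (\<Sum>j\<in>UNIV. \<Lambda> j * U j t * V j s))"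

definition lower_at :: "(('j \<Rightarrow> nat) \<Rightarrow> real \<Rightarrow> 'h::zero) \<Rightarrow> ('j \<Rightarrow> nat) \<Rightarrow> 'j \<Rightarrow> real \<Rightarrow> 'h" where
  "lower_at \<psi> k j t = (if k j = 0 then 0 else \<psi> (k(j := k j - 1)) t)"

definition raise_at :: "(('j \<Rightarrow> nat) \<Rightarrow> real \<Rightarrow> 'h) \<Rightarrow> ('j \<Rightarrow> nat) \<Rightarrow> 'j \<Rightarrow> real \<Rightarrow> 'h" where
  "raise_at \<psi> k j t = \<psi> (k(j := k j + 1)) t"

definition relaxed_hierarchy_sum ::
  "'h::complex_hilbert_space set \<Rightarrow> ('h \<Rightarrow> 'h) \<Rightarrow> ('h \<Rightarrow> 'h) \<Rightarrow> ('h \<Rightarrow> 'h) \<Rightarrow> real \<Rightarrow>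
   ('j::finite \<Rightarrow> nat) set \<Rightarrow>
   ('j \<Rightarrow> complex) \<Rightarrow> ('j \<Rightarrow> real \<Rightarrow> complex) \<Rightarrow> ('j \<Rightarrow> real \<Rightarrow> complex) \<Rightarrow> (real \<Rightarrow> complex) \<Rightarrow>
   (('j \<Rightarrow> nat) \<Rightarrow> real \<Rightarrow> 'h) \<Rightarrow> bool" where
  "relaxed_hierarchy_sum D H L Ld T K \<Lambda> U V \<zeta> \<psi> \<longleftrightarrow>
     (\<forall>k. k \<notin> K \<longrightarrow> (\<forall>t\<in>{0..T}. \<psi> k t = 0)) \<and>
     (\<forall>k\<in>K. \<forall>t\<in>{0..T}. \<psi> k t \<in> D \<and>
        (\<psi> k has_vector_derivative
           ((- \<i>) *\<^sub>C H (\<psi> k t) + \<zeta> t *\<^sub>C L (\<psi> k t)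
            + (\<Sum>j\<in>UNIV. (of_nat (k j) * \<Lambda> j * V j t) *\<^sub>C L (lower_at \<psi> k j t))
            - (\<Sum>j\<in>UNIV. U j t *\<^sub>C Ld (raise_at \<psi> k j t)))) (at t within {0..T}))"

definition hops_hierarchy_sum ::
  "'h::complex_hilbert_space set \<Rightarrow> ('h \<Rightarrow> 'h) \<Rightarrow> ('h \<Rightarrow> 'h) \<Rightarrow> ('h \<Rightarrow> 'h) \<Rightarrow> real \<Rightarrow>
   ('j::finite \<Rightarrow> nat) set \<Rightarrow> ('j \<Rightarrow> complex) \<Rightarrow> ('j \<Rightarrow> complex) \<Rightarrow> (real \<Rightarrow> complex) \<Rightarrow>
   (('j \<Rightarrow> nat) \<Rightarrow> real \<Rightarrow> 'h) \<Rightarrow> bool" where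
  "hops_hierarchy_sum D H L Ld T K g w \<zeta> \<phi> \<longleftrightarrow>
     (\<forall>k. k \<notin> K \<longrightarrow> (\<forall>t\<in>{0..T}. \<phi> k t = 0)) \<and>
     (\<forall>k\<in>K. \<forall>t\<in>{0..T}. \<phi> k t \<in> D \<and>
        (\<phi> k has_vector_derivative
           ((- \<i>) *\<^sub>C H (\<phi> k t) - (\<Sum>j\<in>UNIV. of_nat (k j) * w j) *\<^sub>C \<phi> k t
            + \<zeta> t *\<^sub>C L (\<phi> k t)
            + (\<Sum>j\<in>UNIV. (of_nat (k j) * g j) *\<^sub>C L (lower_at \<phi> k j t))
            - (\<Sum>j\<in>UNIV. Ld (raise_at \<phi> k j t)))) (at t within {0..T}))"

definition hops_transform_sum ::
  "('j::finite \<Rightarrow> complex) \<Rightarrow> (('j \<Rightarrow> nat) \<Rightarrow> real \<Rightarrow> 'h::complex_hilbert_space) \<Rightarrow>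
   ('j \<Rightarrow> nat) \<Rightarrow> real \<Rightarrow> 'h" where
  "hops_transform_sum w \<psi> =
     (\<lambda>k t. exp (- ((\<Sum>j\<in>UNIV. of_nat (k j) * w j) * of_real t)) *\<^sub>C \<psi> k t)"

end

theory Submission
  imports Defs
begin

text \<open>
  Multiplication by \<open>exp (- (c * t))\<close> is an invertible operation on wavefunctions that adds
  the damping term \<open>- c\<close> to the equation of motion. With \<open>c = k * w\<close> the factors of neighbouring
  orders differ by exactly \<open>exp (\<plusminus> w t)\<close>, which cancels the coefficients \<open>U\<close> and \<open>V\<close>.
\<close>

section \<open>Complex scalar multiplication\<close>

lemma norm_scaleC: "norm (c *\<^sub>C x) = cmod c * norm (x :: 'h::complex_hilbert_space)"
proof -
  \<comment> \<open>Homogeneity is read off from \<open>cinner_self\<close>: the linear slot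
    releases \<open>c\<close>, the other slot \<open>cnj c\<close>, and their product is the square
    of \<open>cmod c\<close>.\<close>
  have "complex_of_real ((norm (c *\<^sub>C x))\<^sup>2) = c * cinner (c *\<^sub>C x) x"
    by (simp only: cinner_self[symmetric] cinner_scaleC_right)
  also have "cinner (c *\<^sub>C x) x = cnj (c * cinner x x)"
    by (subst cinner_commute) (simp only: cinner_scaleC_right)
  also have "c * \<dots> = complex_of_real ((cmod c * norm x)\<^sup>2)"
    by (simp add: cinner_self power_mult_distrib flip: complex_norm_square)
  finally have "(norm (c *\<^sub>C x))\<^sup>2 = (cmod c * norm x)\<^sup>2"
    by (simp only: of_real_eq_iff)
  then show ?thesis
    by (simp add: power2_eq_iff_nonneg)
qed

lemma scaleC_eq_0_iff: "c *\<^sub>C x = 0 \<longleftrightarrow> c = 0 \<or> x = (0 :: 'h::complex_hilbert_space)"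
  by (metis norm_scaleC mult_eq_0_iff norm_eq_zero)

text \<open>Supplies the product rule used for derivatives below, and distributivity over
  differences, negation and finite sums.\<close>

lemma bounded_bilinear_scaleC:
  "bounded_bilinear (scaleC :: complex \<Rightarrow> 'h \<Rightarrow> 'h::complex_hilbert_space)"
proof
  show "\<exists>K. \<forall>a b. norm (a *\<^sub>C (b :: 'h)) \<le> norm a * norm b * K"
    by (intro exI[of _ 1]) (simp add: norm_scaleC)
qed (simp_all add: scaleC_add_left scaleC_add_right scaleR_scaleC scaleC_scaleC
    scaleR_conv_of_real mult.commute)

interpretation scaleC:
  bounded_bilinear "scaleC :: complex \<Rightarrow> 'h \<Rightarrow> 'h::complex_hilbert_space"
  by (rule bounded_bilinear_scaleC)

lemma scaleC_one: "1 *\<^sub>C x = (x :: 'h::complex_hilbert_space)"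
  using scaleR_scaleC[of 1 x] by simp

lemma scaleC_exp_exp: "exp c *\<^sub>C exp d *\<^sub>C x = exp (c + d) *\<^sub>C (x :: 'h::complex_hilbert_space)"
  by (simp add: scaleC_scaleC exp_add)

lemma scaleC_exp_cancel:
  "exp (- c) *\<^sub>C exp c *\<^sub>C x = (x :: 'h::complex_hilbert_space)"
  "exp c *\<^sub>C exp (- c) *\<^sub>C x = x"
  by (simp_all add: scaleC_exp_exp scaleC_one)

text \<open>An exponential is invertible, so closure under scalars also works backwards. Hence the
  transform preserves membership in the domain of the Hamiltonian in both directions.\<close>

lemma csubspace_scaleC_exp_iff:
  assumes "csubspace D"
  shows "exp c *\<^sub>C x \<in> D \<longleftrightarrow> x \<in> D"
  using assms scaleC_exp_cancel(1)[of c x] unfolding csubspace_def by metis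

section \<open>Linearity of the adjoint\<close>

lemma cinner_ext:
  assumes "\<And>y. cinner a y = cinner b (y :: 'h::complex_hilbert_space)"
  shows "a = b"
proof -
  have "cinner (a - b) a = cinner (a - b) b"
    using assms cinner_commute by metis
  \<comment> \<open>Additivity is an axiom for sums, so it is applied to
    \<open>(a - b) + b = a\<close>; the difference \<open>a - b\<close> then turns out to have norm
    zero.\<close>
  moreover have "cinner (a - b) (a - b) + cinner (a - b) b = cinner (a - b) a"
    by (simp flip: cinner_add_right)
  ultimately have "cinner (a - b) (a - b) = 0" by simp
  then show ?thesis by (simp add: cinner_self)
qed

text \<open>\<open>is_cadjoint\<close> is only an inner product identity, whereas the transform must
  pull scalars through \<open>Ld\<close>. Moving \<open>B\<close> across the inner product leaves
  \<open>x\<close> in the linear slot, and \<open>cinner_ext\<close> removes the test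
  vector.\<close>

lemma is_cadjoint_clinear:
  assumes "is_cadjoint A B"
  shows "clinear_on UNIV B"
proof -
  have B: "cinner y (B x) = cinner (A y) x" for x y
    using assms cinner_commute unfolding is_cadjoint_def by metis
  have "B (x + y) = B x + B y" for x y
  proof (rule cinner_ext)
    fix u
    have "cinner u (B (x + y)) = cinner u (B x + B y)"
      by (simp add: B cinner_add_right)
    then show "cinner (B (x + y)) u = cinner (B x + B y) u"
      using cinner_commute by metis
  qed
  moreover have "B (c *\<^sub>C x) = c *\<^sub>C B x" for c x
  proof (rule cinner_ext)
    fix u
    have "cinner u (B (c *\<^sub>C x)) = cinner u (c *\<^sub>C B x)"
      by (simp add: B cinner_scaleC_right)
    then show "cinner (B (c *\<^sub>C x)) u = cinner (c *\<^sub>C B x) u"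
      using cinner_commute by metis
  qed
  ultimately show ?thesis by (simp add: clinear_on_def)
qed

lemma clinear_on_scaleC: "clinear_on D A \<Longrightarrow> x \<in> D \<Longrightarrow> A (c *\<^sub>C x) = c *\<^sub>C A x"
  by (simp add: clinear_on_def)

section \<open>Derivatives under an exponential factor\<close>

lemma has_vector_derivative_scaleC_exp:
  fixes f :: "real \<Rightarrow> 'h::complex_hilbert_space"
  assumes "(f has_vector_derivative X) (at t within S)"
  shows "((\<lambda>t. exp (- (c * of_real t)) *\<^sub>C f t) has_vector_derivative
           exp (- (c * of_real t)) *\<^sub>C X - c *\<^sub>C exp (- (c * of_real t)) *\<^sub>C f t) (at t within S)"
proof -
  \<comment> \<open>The factor is differentiated as a function of a complex variable and then
    restricted to real times.\<close>
  have "((\<lambda>z. exp (- (c * z))) has_field_derivative - c * exp (- (c * of_real t))) (at (of_real t))"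
    by (auto intro!: derivative_eq_intros)
  then have "((\<lambda>t. exp (- (c * of_real t))) has_vector_derivative - c * exp (- (c * of_real t)))
      (at t within S)"
    by (rule has_vector_derivative_real_field)
  from scaleC.has_vector_derivative[OF this assms] show ?thesis
    by (simp add: scaleC_scaleC scaleC.minus_left)
qed

lemma has_vector_derivative_scaleC_exp_iff:
  fixes f :: "real \<Rightarrow> 'h::complex_hilbert_space"
  shows "((\<lambda>t. exp (- (c * of_real t)) *\<^sub>C f t) has_vector_derivative
           exp (- (c * of_real t)) *\<^sub>C X - c *\<^sub>C exp (- (c * of_real t)) *\<^sub>C f t) (at t within S)
         \<longleftrightarrow> (f has_vector_derivative X) (at t within S)"
    (is "(?g has_vector_derivative ?Y) _ \<longleftrightarrow> _")
proof
  assume "(?g has_vector_derivative ?Y) (at t within S)"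
  \<comment> \<open>The opposite rate undoes the factor: the product rule now adds
    \<open>c *\<^sub>C f t\<close>, which cancels the damping term and leaves
    \<open>X\<close>.\<close>
  from has_vector_derivative_scaleC_exp[OF this, of "- c"]
  show "(f has_vector_derivative X) (at t within S)"
    by (simp add: scaleC.diff_right scaleC.minus_left scaleC_exp_cancel)
      (simp add: scaleC_scaleC scaleC_one ac_simps flip: exp_add)
qed (rule has_vector_derivative_scaleC_exp)

section \<open>Bijectivity of the transforms\<close>

text \<open>Turns an equivalence of hierarchies into a bijection of solution sets. Surjectivity of
  \<open>f\<close> ensures that every solution of the second hierarchy is reached.\<close>

lemma bij_betw_Collect_iff:
  assumes "bij f" "\<And>x. P x \<longleftrightarrow> Q (f x)"
  shows "bij_betw f {x. P x} {y. Q y}"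
proof -
  have "f -` {y. Q y} = {x. P x}"
    using assms(2) by auto
  then have "f ` {x. P x} = {y. Q y}"
    using surj_image_vimage_eq[OF bij_is_surj[OF assms(1)]] by metis
  then show ?thesis
    using bij_betw_subset[OF assms(1) subset_UNIV] by metis
qed

text \<open>The inverse is the transform with rate \<open>- w\<close>, on all families of
  wavefunctions and not only on solutions.\<close>

lemma bij_hops_transform: "bij (hops_transform w)"
  by (rule o_bij[where g = "hops_transform (- w)"])
    (simp_all add: hops_transform_def fun_eq_iff scaleC_exp_cancel)

lemma bij_hops_transform_sum: "bij (hops_transform_sum w)"
  by (rule o_bij[where g = "hops_transform_sum (\<lambda>j. - w j)"])
    (simp_all add: hops_transform_sum_def fun_eq_iff scaleC_exp_cancel sum_negf)

section \<open>Exponential factors of neighbouring orders\<close>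

text \<open>Order \<open>k - 1\<close> carries one factor \<open>exp (- w t)\<close> fewer than
  order \<open>k\<close>; the surplus \<open>exp (w t)\<close> is the coefficient \<open>V\<close>.
  For \<open>k = 0\<close> both sides vanish by the convention in \<open>lower\<close>.\<close>

lemma lower_hops_transform:
  "lower (hops_transform w \<psi>) k t =
     exp (w * of_real t) *\<^sub>C exp (- (of_nat k * w * of_real t)) *\<^sub>C lower \<psi> k t"
  by (cases k)
    (simp_all add: lower_def hops_transform_def scaleC.zero_right scaleC_exp_exp algebra_simps)

text \<open>The additional factor relative to order \<open>k\<close> is the coefficient
  \<open>U\<close>.\<close>

lemma hops_transform_Suc:
  "hops_transform w \<psi> (k + 1) t =
     exp (- (w * of_real t)) *\<^sub>C exp (- (of_nat k * w * of_real t)) *\<^sub>C \<psi> (k + 1) t"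
  by (simp add: hops_transform_def scaleC_exp_exp algebra_simps)

text \<open>Serves both shifts of a multi-index. The difference is taken in the complex numbers, so
  it may be negative without truncation.\<close>

lemma sum_fun_upd_weighted:
  fixes w :: "'j::finite \<Rightarrow> complex"
  shows "(\<Sum>i\<in>UNIV. of_nat ((k(j := n)) i) * w i) =
    (\<Sum>i\<in>UNIV. of_nat (k i) * w i) + (of_nat n - of_nat (k j)) * w j"
proof -
  have "(\<Sum>i\<in>UNIV. of_nat ((k(j := n)) i) * w i) =
      (\<Sum>i\<in>UNIV. of_nat (k i) * w i + (if i = j then (of_nat n - of_nat (k j)) * w j else 0))"
    by (rule sum.cong) (auto simp: algebra_simps)
  then show ?thesis by (simp add: sum.distrib)
qed

lemma lower_at_hops_transform_sum:
  "lower_at (hops_transform_sum w \<psi>) k j t =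
     exp (w j * of_real t) *\<^sub>C exp (- ((\<Sum>i\<in>UNIV. of_nat (k i) * w i) * of_real t)) *\<^sub>C
       lower_at \<psi> k j t"
proof (cases "k j = 0")
  case False
  let ?c = "\<Sum>i\<in>UNIV. of_nat (k i) * w i"
  \<comment> \<open>Since \<open>k j\<close> is nonzero, the natural subtraction is genuine and the
    bracketed difference equals -1.\<close>
  have "- ((?c + (of_nat (k j - 1) - of_nat (k j)) * w j) * of_real t) =
      w j * of_real t + - (?c * of_real t)"
    using False by (simp only: of_nat_diff) (simp add: ring_distribs)
  then show ?thesis
    using False
    by (simp only: lower_at_def hops_transform_sum_def sum_fun_upd_weighted scaleC_exp_exp if_False)
qed (simp add: lower_at_def scaleC.zero_right)

lemma raise_at_hops_transform_sum:
  "raise_at (hops_transform_sum w \<psi>) k j t =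
     exp (- (w j * of_real t)) *\<^sub>C exp (- ((\<Sum>i\<in>UNIV. of_nat (k i) * w i) * of_real t)) *\<^sub>C
       raise_at \<psi> k j t"
proof -
  let ?c = "\<Sum>i\<in>UNIV. of_nat (k i) * w i"
  have "- ((?c + (of_nat (k j + 1) - of_nat (k j)) * w j) * of_real t) =
      - (w j * of_real t) + - (?c * of_real t)"
    by (simp add: ring_distribs)
  then show ?thesis
    by (simp only: raise_at_def hops_transform_sum_def sum_fun_upd_weighted scaleC_exp_exp)
qed

section \<open>Equivalence of the two hierarchies along one noise path\<close>

lemma relaxed_hierarchy_iff_hops:
  fixes H L Ld :: "'h::complex_hilbert_space \<Rightarrow> 'h"
  assumes D: "csubspace D" and H: "clinear_on D H"
    and L: "clinear_on UNIV L" and Ld: "clinear_on UNIV Ld"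
  shows "relaxed_hierarchy D H L Ld T N
           g (\<lambda>t. exp (- (w * of_real t))) (\<lambda>t. exp (w * of_real t)) \<zeta> \<psi>
         \<longleftrightarrow> hops_hierarchy D H L Ld T N g w \<zeta> (hops_transform w \<psi>)"
proof -
  let ?\<phi> = "hops_transform w \<psi>"
  let ?X = "\<lambda>k t. (- \<i>) *\<^sub>C H (\<psi> k t) + \<zeta> t *\<^sub>C L (\<psi> k t)
            + (of_nat k * g * exp (w * of_real t)) *\<^sub>C L (lower \<psi> k t)
            - exp (- (w * of_real t)) *\<^sub>C Ld (\<psi> (k + 1) t)"
  let ?Y = "\<lambda>k t. (- \<i>) *\<^sub>C H (?\<phi> k t) - (of_nat k * w) *\<^sub>C ?\<phi> k t + \<zeta> t *\<^sub>C L (?\<phi> k t)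
            + (of_nat k * g) *\<^sub>C L (lower ?\<phi> k t) - Ld (?\<phi> (k + 1) t)"
  \<comment> \<open>The factor never vanishes, so the truncation condition transfers both
    ways.\<close>
  have zero: "?\<phi> k t = 0 \<longleftrightarrow> \<psi> k t = 0" for k t
    by (simp add: hops_transform_def scaleC_eq_0_iff)
  have dom: "?\<phi> k t \<in> D \<longleftrightarrow> \<psi> k t \<in> D" for k t
    by (simp add: hops_transform_def csubspace_scaleC_exp_iff[OF D])
  \<comment> \<open>The domain condition is required because \<open>H\<close> commutes with scalars
    only on \<open>D\<close>; \<open>dom\<close> provides it starting from either hierarchy.\<close>
  have deriv: "(?\<phi> k has_vector_derivative ?Y k t) (at t within {0..T}) \<longleftrightarrow>
      (\<psi> k has_vector_derivative ?X k t) (at t within {0..T})" if "\<psi> k t \<in> D" for k t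
  proof -
    \<comment> \<open>Pulling the common factor out by linearity puts the HOPS right-hand side in
      the exact form produced by the product rule, so the derivative equivalence applies with
      \<open>?X\<close> as derivative.\<close>
    have "?Y k t = exp (- (of_nat k * w * of_real t)) *\<^sub>C ?X k t
        - (of_nat k * w) *\<^sub>C exp (- (of_nat k * w * of_real t)) *\<^sub>C \<psi> k t"
      unfolding lower_hops_transform hops_transform_Suc
      by (simp add: hops_transform_def clinear_on_scaleC[OF H that] clinear_on_scaleC[OF L]
          clinear_on_scaleC[OF Ld] scaleC.add_right scaleC.diff_right scaleC_scaleC ac_simps)
    then show ?thesis
      by (simp only: hops_transform_def has_vector_derivative_scaleC_exp_iff)
  qed
  show ?thesis
    unfolding relaxed_hierarchy_def hops_hierarchy_def using zero dom deriv by blast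
qed

text \<open>The transform rescales each multi-index separately by a nonzero factor, so vanishing
  outside \<open>K\<close> is preserved for any truncation set \<open>K\<close>.\<close>

lemma relaxed_hierarchy_sum_iff_hops:
  fixes H L Ld :: "'h::complex_hilbert_space \<Rightarrow> 'h"
  assumes D: "csubspace D" and H: "clinear_on D H"
    and L: "clinear_on UNIV L" and Ld: "clinear_on UNIV Ld"
  shows "relaxed_hierarchy_sum D H L Ld T K
           g (\<lambda>j t. exp (- (w j * of_real t))) (\<lambda>j t. exp (w j * of_real t)) \<zeta> \<psi>
         \<longleftrightarrow> hops_hierarchy_sum D H L Ld T K g w \<zeta> (hops_transform_sum w \<psi>)"
proof -
  let ?\<phi> = "hops_transform_sum w \<psi>"
  let ?c = "\<lambda>k. \<Sum>j\<in>UNIV. of_nat (k j) * w j"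
  let ?X = "\<lambda>k t. (- \<i>) *\<^sub>C H (\<psi> k t) + \<zeta> t *\<^sub>C L (\<psi> k t)
            + (\<Sum>j\<in>UNIV. (of_nat (k j) * g j * exp (w j * of_real t)) *\<^sub>C L (lower_at \<psi> k j t))
            - (\<Sum>j\<in>UNIV. exp (- (w j * of_real t)) *\<^sub>C Ld (raise_at \<psi> k j t))"
  let ?Y = "\<lambda>k t. (- \<i>) *\<^sub>C H (?\<phi> k t) - ?c k *\<^sub>C ?\<phi> k t + \<zeta> t *\<^sub>C L (?\<phi> k t)
            + (\<Sum>j\<in>UNIV. (of_nat (k j) * g j) *\<^sub>C L (lower_at ?\<phi> k j t))
            - (\<Sum>j\<in>UNIV. Ld (raise_at ?\<phi> k j t))"
  have zero: "?\<phi> k t = 0 \<longleftrightarrow> \<psi> k t = 0" for k t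
    by (simp add: hops_transform_sum_def scaleC_eq_0_iff)
  have dom: "?\<phi> k t \<in> D \<longleftrightarrow> \<psi> k t \<in> D" for k t
    by (simp add: hops_transform_sum_def csubspace_scaleC_exp_iff[OF D])
  have deriv: "(?\<phi> k has_vector_derivative ?Y k t) (at t within {0..T}) \<longleftrightarrow>
      (\<psi> k has_vector_derivative ?X k t) (at t within {0..T})" if "\<psi> k t \<in> D" for k t
  proof -
    \<comment> \<open>The common factor leaves the sums over \<open>j\<close>, and each summand
      keeps its own \<open>exp (w j t)\<close> or \<open>exp (- w j t)\<close>, matching
      \<open>V j\<close> and \<open>U j\<close>.\<close>
    have "?Y k t = exp (- (?c k * of_real t)) *\<^sub>C ?X k t
        - ?c k *\<^sub>C exp (- (?c k * of_real t)) *\<^sub>C \<psi> k t"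
      unfolding lower_at_hops_transform_sum raise_at_hops_transform_sum
      by (simp add: hops_transform_sum_def clinear_on_scaleC[OF H that] clinear_on_scaleC[OF L]
          clinear_on_scaleC[OF Ld] scaleC.add_right scaleC.diff_right scaleC.sum_right
          scaleC_scaleC ac_simps)
    then show ?thesis
      by (simp only: hops_transform_sum_def has_vector_derivative_scaleC_exp_iff)
  qed
  show ?thesis
    unfolding relaxed_hierarchy_sum_def hops_hierarchy_sum_def using zero dom deriv by blast
qed

section \<open>Separability and the final statement\<close>

lemma separable_bcf_exp:
  assumes "\<And>s t. 0 \<le> s \<and> s \<le> t \<and> t \<le> T \<Longrightarrow> \<alpha> t s = g * exp (- (w * of_real (t - s)))"
  shows "separable_bcf T \<alpha> g (\<lambda>t. exp (- (w * of_real t))) (\<lambda>t. exp (w * of_real t))"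
  unfolding separable_bcf_def
  by (simp add: assms algebra_simps flip: exp_add)

lemma separable_bcf_sum_exp:
  assumes "\<And>s t. 0 \<le> s \<and> s \<le> t \<and> t \<le> T \<Longrightarrow>
    \<alpha> t s = (\<Sum>j\<in>UNIV. g j * exp (- (w j * of_real (t - s))))"
  shows "separable_bcf_sum T \<alpha> g (\<lambda>j t. exp (- (w j * of_real t))) (\<lambda>j t. exp (w j * of_real t))"
  unfolding separable_bcf_sum_def
  by (simp add: assms algebra_simps flip: exp_add)

theorem mainTheorem8:
  fixes D :: "'h::complex_hilbert_space set"
    and H L Ld :: "'h \<Rightarrow> 'h"
    and T :: real
    and M :: "'w measure"
    and z :: "real \<Rightarrow> 'w \<Rightarrow> complex"
    and \<alpha> :: "real \<Rightarrow> real \<Rightarrow> complex"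
  assumes separable: "\<exists>S :: 'h set. countable S \<and> closure S = UNIV"
    and T: "0 < T"
    and H: "self_adjoint_operator D H"
    and L: "bounded_clinear L"
    and Ld: "is_cadjoint L Ld"
    and z: "gaussian_noise M T \<alpha> z"
  shows
    "(\<forall>g w N.
        (\<forall>s t. 0 \<le> s \<and> s \<le> t \<and> t \<le> T \<longrightarrow> \<alpha> t s = g * exp (- (w * of_real (t - s))))
        \<longrightarrow>
        separable_bcf T \<alpha> g (\<lambda>t. exp (- (w * of_real t))) (\<lambda>t. exp (w * of_real t)) \<and>
        (\<forall>\<omega>\<in>space M.
           (\<forall>\<psi>. relaxed_hierarchy D H L Ld T N
                   g (\<lambda>t. exp (- (w * of_real t))) (\<lambda>t. exp (w * of_real t)) (\<lambda>t. z t \<omega>) \<psi>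
                 \<longleftrightarrow> hops_hierarchy D H L Ld T N g w (\<lambda>t. z t \<omega>) (hops_transform w \<psi>)) \<and>
           bij_betw (hops_transform w)
             {\<psi>. relaxed_hierarchy D H L Ld T N
                   g (\<lambda>t. exp (- (w * of_real t))) (\<lambda>t. exp (w * of_real t)) (\<lambda>t. z t \<omega>) \<psi>}
             {\<phi>. hops_hierarchy D H L Ld T N g w (\<lambda>t. z t \<omega>) \<phi>}))
     \<and>
     (\<forall>(\<gamma>::real) N.
        (\<forall>s\<in>{0..T}. \<forall>t\<in>{0..T}. \<alpha> t s = of_real (\<gamma> / 2 * exp (- \<gamma> * \<bar>t - s\<bar>)))
        \<longrightarrow>
        separable_bcf T \<alpha> (of_real (\<gamma> / 2))
          (\<lambda>t. of_real (exp (- \<gamma> * t))) (\<lambda>t. of_real (exp (\<gamma> * t))) \<and>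
        (\<forall>\<omega>\<in>space M.
           (\<forall>\<psi>. relaxed_hierarchy D H L Ld T N (of_real (\<gamma> / 2))
                   (\<lambda>t. of_real (exp (- \<gamma> * t))) (\<lambda>t. of_real (exp (\<gamma> * t))) (\<lambda>t. z t \<omega>) \<psi>
                 \<longleftrightarrow> hops_hierarchy D H L Ld T N (of_real (\<gamma> / 2)) (of_real \<gamma>) (\<lambda>t. z t \<omega>)
                       (hops_transform (of_real \<gamma>) \<psi>)) \<and>
           bij_betw (hops_transform (of_real \<gamma>))
             {\<psi>. relaxed_hierarchy D H L Ld T N (of_real (\<gamma> / 2))
                   (\<lambda>t. of_real (exp (- \<gamma> * t))) (\<lambda>t. of_real (exp (\<gamma> * t))) (\<lambda>t. z t \<omega>) \<psi>}
             {\<phi>. hops_hierarchy D H L Ld T N (of_real (\<gamma> / 2)) (of_real \<gamma>) (\<lambda>t. z t \<omega>) \<phi>}))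
     \<and>
     (\<forall>(g :: 'j::finite \<Rightarrow> complex) w K.
        finite K \<and>
        (\<forall>s t. 0 \<le> s \<and> s \<le> t \<and> t \<le> T \<longrightarrow>
           \<alpha> t s = (\<Sum>j\<in>UNIV. g j * exp (- (w j * of_real (t - s)))))
        \<longrightarrow>
        separable_bcf_sum T \<alpha> g
          (\<lambda>j t. exp (- (w j * of_real t))) (\<lambda>j t. exp (w j * of_real t)) \<and>
        (\<forall>\<omega>\<in>space M.
           (\<forall>\<psi>. relaxed_hierarchy_sum D H L Ld T K g
                   (\<lambda>j t. exp (- (w j * of_real t))) (\<lambda>j t. exp (w j * of_real t))
                   (\<lambda>t. z t \<omega>) \<psi>
                 \<longleftrightarrow> hops_hierarchy_sum D H L Ld T K g w (\<lambda>t. z t \<omega>) (hops_transform_sum w \<psi>)) \<and>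
           bij_betw (hops_transform_sum w)
             {\<psi>. relaxed_hierarchy_sum D H L Ld T K g
                   (\<lambda>j t. exp (- (w j * of_real t))) (\<lambda>j t. exp (w j * of_real t))
                   (\<lambda>t. z t \<omega>) \<psi>}
             {\<phi>. hops_hierarchy_sum D H L Ld T K g w (\<lambda>t. z t \<omega>) \<phi>}))"
proof -
  have D: "csubspace D" and lin: "clinear_on D H"
    using H by (simp_all add: self_adjoint_operator_def)
  have L': "clinear_on UNIV L"
    using L by (simp add: bounded_clinear_def)
  note iff = relaxed_hierarchy_iff_hops[OF D lin L' is_cadjoint_clinear[OF Ld]]
  note iff_sum = relaxed_hierarchy_sum_iff_hops[OF D lin L' is_cadjoint_clinear[OF Ld]]
  \<comment> \<open>Identifies the real coefficients of the \<gamma> case with complex exponentials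
    of rate \<open>of_real \<gamma>\<close>, so that \<open>single\<close> covers it as
    well.\<close>
  have exp_real: "(\<lambda>t. complex_of_real (exp (- \<gamma> * t))) = (\<lambda>t. exp (- (of_real \<gamma> * of_real t)))"
    "(\<lambda>t. complex_of_real (exp (\<gamma> * t))) = (\<lambda>t. exp (of_real \<gamma> * of_real t))" for \<gamma>
    by (simp_all add: exp_of_real[symmetric])
  have single: "separable_bcf T \<alpha> g (\<lambda>t. exp (- (w * of_real t))) (\<lambda>t. exp (w * of_real t)) \<and>
      (\<forall>\<omega>\<in>space M.
         (\<forall>\<psi>. relaxed_hierarchy D H L Ld T N
                 g (\<lambda>t. exp (- (w * of_real t))) (\<lambda>t. exp (w * of_real t)) (\<lambda>t. z t \<omega>) \<psi>
               \<longleftrightarrow> hops_hierarchy D H L Ld T N g w (\<lambda>t. z t \<omega>) (hops_transform w \<psi>)) \<and>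
         bij_betw (hops_transform w)
           {\<psi>. relaxed_hierarchy D H L Ld T N
                 g (\<lambda>t. exp (- (w * of_real t))) (\<lambda>t. exp (w * of_real t)) (\<lambda>t. z t \<omega>) \<psi>}
           {\<phi>. hops_hierarchy D H L Ld T N g w (\<lambda>t. z t \<omega>) \<phi>})"
    if "\<forall>s t. 0 \<le> s \<and> s \<le> t \<and> t \<le> T \<longrightarrow> \<alpha> t s = g * exp (- (w * of_real (t - s)))" for g w N
  proof (intro conjI ballI allI)
    show "separable_bcf T \<alpha> g (\<lambda>t. exp (- (w * of_real t))) (\<lambda>t. exp (w * of_real t))"
      by (rule separable_bcf_exp) (simp add: that)
  \<comment> \<open>The equivalence holds for an arbitrary path, so it is instantiated at each
    \<omega> separately; the same equivalence then discharges the premise of the bijection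
    rule.\<close>
  qed (rule iff bij_betw_Collect_iff[OF bij_hops_transform])+
  show ?thesis
  proof (intro conjI, goal_cases)
    case 1
    show ?case using single by blast
  next
    case 2
    show ?case
    proof (intro allI impI)
      fix \<gamma> :: real and N
      assume \<alpha>: "\<forall>s\<in>{0..T}. \<forall>t\<in>{0..T}. \<alpha> t s = of_real (\<gamma> / 2 * exp (- \<gamma> * \<bar>t - s\<bar>))"
      \<comment> \<open>On the region where \<open>s\<close> is at most \<open>t\<close> the
        absolute value is \<open>t - s\<close>, giving the exponential form with
        \<open>g = \<gamma> / 2\<close> and \<open>w = \<gamma>\<close>.\<close>
      have "\<forall>s t. 0 \<le> s \<and> s \<le> t \<and> t \<le> T \<longrightarrow>
          \<alpha> t s = of_real (\<gamma> / 2) * exp (- (of_real \<gamma> * of_real (t - s)))"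
        using \<alpha> by (simp add: exp_of_real[symmetric])
      from single[OF this, of N] show "separable_bcf T \<alpha> (of_real (\<gamma> / 2))
          (\<lambda>t. of_real (exp (- \<gamma> * t))) (\<lambda>t. of_real (exp (\<gamma> * t))) \<and>
        (\<forall>\<omega>\<in>space M.
           (\<forall>\<psi>. relaxed_hierarchy D H L Ld T N (of_real (\<gamma> / 2))
                   (\<lambda>t. of_real (exp (- \<gamma> * t))) (\<lambda>t. of_real (exp (\<gamma> * t))) (\<lambda>t. z t \<omega>) \<psi>
                 \<longleftrightarrow> hops_hierarchy D H L Ld T N (of_real (\<gamma> / 2)) (of_real \<gamma>) (\<lambda>t. z t \<omega>)
                       (hops_transform (of_real \<gamma>) \<psi>)) \<and>
           bij_betw (hops_transform (of_real \<gamma>))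
             {\<psi>. relaxed_hierarchy D H L Ld T N (of_real (\<gamma> / 2))
                   (\<lambda>t. of_real (exp (- \<gamma> * t))) (\<lambda>t. of_real (exp (\<gamma> * t))) (\<lambda>t. z t \<omega>) \<psi>}
             {\<phi>. hops_hierarchy D H L Ld T N (of_real (\<gamma> / 2)) (of_real \<gamma>) (\<lambda>t. z t \<omega>) \<phi>})"
        unfolding exp_real .
    qed
  next
    case 3
    show ?case
    proof (intro allI impI conjI ballI)
      fix g w :: "'j \<Rightarrow> complex" and K :: "('j \<Rightarrow> nat) set"
      assume "finite K \<and> (\<forall>s t. 0 \<le> s \<and> s \<le> t \<and> t \<le> T \<longrightarrow>
          \<alpha> t s = (\<Sum>j\<in>UNIV. g j * exp (- (w j * of_real (t - s)))))"
      then show "separable_bcf_sum T \<alpha> g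
          (\<lambda>j t. exp (- (w j * of_real t))) (\<lambda>j t. exp (w j * of_real t))"
        by (intro separable_bcf_sum_exp) simp
    qed (rule iff_sum bij_betw_Collect_iff[OF bij_hops_transform_sum])+
  qed
qed

end
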